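(* Let $\pi/2\le\alpha<\pi$. Then the equation $$\frac{1}{4\sin^2\alpha}\Big\{\log\big[N(r,\alpha)\big]\Big\}^2-\frac{1}{\sin\alpha}\big[M_1(r,\alpha)-M_2(r,\alpha)\big]-1=0\qquad(0\le r<1)$$ has a least positive root $r_2\in(0,1)$, and $\mathcal{MS}(\alpha)\subset\mathcal{PS}$ for $|z|\le r_2$; that is, for every $f\in\mathcal{MS}(\alpha)$, $$\left|\frac{zf'(z)}{f(z)}-1\right|\le\Re\left(\frac{zf'(z)}{f(z)}\right)\qquad(|z|\le r_2).$$
   Context: $\mathbb{U}=\{z\in\mathbb{C}:|z|<1\}$. $\mathcal{A}$ is the class of functions $f(z)=z+\sum_{n=2}^\infty a_nz^n$ that are analytic and univalent in $\mathbb{U}$. For $\pi/2\le\alpha<\pi$, $\mathcal{MS}(\alpha)$ is the class of all $f\in\mathcal{A}$ such that $$1+\frac{\alpha-\pi}{2\sin\alpha}<\Re\left(\frac{zf'(z)}{f(z)}\right)<1+\frac{\alpha}{2\sin\alpha}\qquad(z\in\mathbb{U}),$$ where $zf'(z)/f(z)$ is given the value $1$ at $z=0$. $\mathcal{PS}$ is the class of parabolic starlike functions: $f\in\mathcal{A}$ with $|zf'(z)/f(z)-1|\le\Re(zf'(z)/f(z))$ for $z\in\mathbb{U}$. An inclusion "for $|z|\le\rho$" means that every function of the first class satisfies the defining condition of the second class at all $z$ with $|z|\le\rho$. For $0\le r<1$, $$M_1(r,\alpha)=\arcsin\left(\frac{-r^2\sin2\alpha}{\sqrt{1-2r^2\cos2\alpha+r^4}}\right),\qquad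 M_2(r,\alpha)=\arcsin\left(\frac{2r\sin\alpha}{\sqrt{1-2r^2\cos2\alpha+r^4}}\right),$$ $$N(r,\alpha)=\frac{\sqrt{1-2r^2\cos2\alpha+r^4}+2r\sin\alpha}{1-r^2},$$ with $\arcsin$ taking values in $[-\pi/2,\pi/2]$. *)

theory Defs
  imports "HOL-Complex_Analysis.Complex_Analysis"
begin

abbreviation unit_disc :: "complex set" where
  "unit_disc \<equiv> ball 0 1"

definition class_A :: "(complex \<Rightarrow> complex) set" where
  "class_A = {f. f holomorphic_on unit_disc \<and> inj_on f unit_disc \<and>
     (\<exists>a. \<forall>z\<in>unit_disc. (\<lambda>n. a (n + 2) * z ^ (n + 2)) sums (f z - z))}"

text \<open>The quotient \<open>z f'(z) / f(z)\<close>, with its removable singularity at \<open>0\<close> filled in.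
  For \<open>f\<close> in \<open>class_A\<close> the denominator vanishes in the unit disc only at \<open>0\<close>.\<close>

definition star_quot :: "(complex \<Rightarrow> complex) \<Rightarrow> complex \<Rightarrow> complex" where
  "star_quot f z = (if z = 0 then 1 else z * deriv f z / f z)"

definition MS :: "real \<Rightarrow> (complex \<Rightarrow> complex) set" where
  "MS \<alpha> = {f \<in> class_A. \<forall>z\<in>unit_disc.
     1 + (\<alpha> - pi) / (2 * sin \<alpha>) < Re (star_quot f z) \<and>
     Re (star_quot f z) < 1 + \<alpha> / (2 * sin \<alpha>)}"

definition parabolic_at :: "(complex \<Rightarrow> complex) \<Rightarrow> complex \<Rightarrow> bool" where
  "parabolic_at f z \<longleftrightarrow> cmod (star_quot f z - 1) \<le> Re (star_quot f z)"

definition PS :: "(complex \<Rightarrow> complex) set" where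
  "PS = {f \<in> class_A. \<forall>z\<in>unit_disc. parabolic_at f z}"

definition M1 :: "real \<Rightarrow> real \<Rightarrow> real" where
  "M1 r \<alpha> = arcsin (- (r\<^sup>2 * sin (2 * \<alpha>)) / sqrt (1 - 2 * r\<^sup>2 * cos (2 * \<alpha>) + r ^ 4))"

definition M2 :: "real \<Rightarrow> real \<Rightarrow> real" where
  "M2 r \<alpha> = arcsin (2 * r * sin \<alpha> / sqrt (1 - 2 * r\<^sup>2 * cos (2 * \<alpha>) + r ^ 4))"

definition N :: "real \<Rightarrow> real \<Rightarrow> real" where
  "N r \<alpha> = (sqrt (1 - 2 * r\<^sup>2 * cos (2 * \<alpha>) + r ^ 4) + 2 * r * sin \<alpha>) / (1 - r\<^sup>2)"

definition radius_eq :: "real \<Rightarrow> real \<Rightarrow> bool" where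
  "radius_eq \<alpha> r \<longleftrightarrow>
     1 / (4 * (sin \<alpha>)\<^sup>2) * (ln (N r \<alpha>))\<^sup>2 - 1 / sin \<alpha> * (M1 r \<alpha> - M2 r \<alpha>) - 1 = 0"

end

theory Submission
  imports Defs
begin

text \<open>
  Write \<open>s = sin \<alpha>\<close>, \<open>a = cis \<alpha>\<close> and \<open>q = z f'(z) / f(z)\<close>. The strip that defines
  \<^const>\<open>MS\<close> is the image of the unit disc under
  \<open>\<zeta> \<mapsto> 1 + 1 / (2 \<i> s) * log ((1 + \<zeta> a) / (1 + \<zeta> (cnj a)))\<close>, a conformal map that sends \<open>0\<close> to
  \<open>1 = q(0)\<close>. The Schwarz lemma, applied to its inverse composed with \<open>q\<close>, shows that with
  \<open>T = 2 \<i> s (q - 1)\<close> one has \<open>exp T = (1 + \<zeta> a) / (1 + \<zeta> (cnj a))\<close> for some \<open>\<zeta>\<close> with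
  \<open>cmod \<zeta> \<le> cmod z\<close> (lemma \<open>strip_subordination\<close>).

  If \<open>cmod z \<le> r\<close>, the Moebius image \<open>exp T\<close> lies in the closed disc with centre
  \<open>C = (1 - r\<^sup>2 a\<^sup>2) / (1 - r\<^sup>2)\<close> and radius \<open>R = 2 r s / (1 - r\<^sup>2)\<close> (lemma \<open>moebius_in_disc\<close>). The
  three functions in the radius equation describe this disc: \<open>M1\<close> is the argument of \<open>C\<close>, \<open>M2\<close> is
  half of the angle that the disc subtends at the origin, and \<open>N = cmod C + R\<close> is its largest
  modulus. Moreover \<open>(cmod C)\<^sup>2 - R\<^sup>2 = 1\<close>, so its smallest modulus is \<open>1 / N\<close>. Therefore
  \<open>\<bar>Re T\<bar> \<le> ln N\<close> and \<open>Im T \<ge> M1 - M2\<close> (lemmas \<open>abs_ln_cmod_le_ln_N\<close> and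
  \<open>Im_log_ge_M1_M2\<close>).

  The parabolic condition on \<open>q\<close> is \<open>(Im q)\<^sup>2 \<le> 2 * Re q - 1\<close>, which in terms of \<open>T\<close> reads
  \<open>(Re T)\<^sup>2 / (4 s\<^sup>2) \<le> Im T / s + 1\<close>. By the two bounds it holds at every \<open>z\<close> with
  \<open>cmod z \<le> r\<close> as soon as the left-hand side of the radius equation is at most \<open>0\<close> at \<open>r\<close>
  (lemma \<open>MS_parabolic_at\<close>); in particular it holds when \<open>r\<close> is a root. The left-hand side
  is continuous on \<open>[0, 1)\<close>, equals \<open>-1\<close> at \<open>0\<close> and is positive somewhere, so a least root exists.
\<close>

section \<open>The disc that governs the radius equation\<close>

text \<open>The square root in \<^const>\<open>M1\<close>, \<^const>\<open>M2\<close> and \<^const>\<open>N\<close> is the modulus of the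
  unnormalised centre \<open>(1 - r\<^sup>2) C\<close> of the disc.\<close>

lemma root_eq_cmod:
  "sqrt (1 - 2 * r\<^sup>2 * cos (2 * \<alpha>) + r ^ 4) = cmod (1 - of_real (r\<^sup>2) * cis (2 * \<alpha>))"
proof -
  have "(1 - r\<^sup>2 * cos (2 * \<alpha>))\<^sup>2 + (r\<^sup>2 * sin (2 * \<alpha>))\<^sup>2
      = 1 - 2 * r\<^sup>2 * cos (2 * \<alpha>) + r ^ 4 * ((sin (2 * \<alpha>))\<^sup>2 + (cos (2 * \<alpha>))\<^sup>2)"
    by (simp only: power2_eq_square power4_eq_xxxx) algebra
  then show ?thesis
    by (simp add: cmod_def)
qed

text \<open>After division by \<open>(1 - r\<^sup>2)\<^sup>2\<close> this is \<open>(cmod C)\<^sup>2 = 1 + R\<^sup>2\<close>: the origin lies outside the disc,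
  and the length of the tangent from it to the disc is \<open>1\<close>.\<close>

lemma cmod_centre_sq:
  "(cmod (1 - of_real (r\<^sup>2) * cis (2 * \<alpha>)))\<^sup>2 = (1 - r\<^sup>2)\<^sup>2 + (2 * r * sin \<alpha>)\<^sup>2"
proof -
  have "(cmod (1 - of_real (r\<^sup>2) * cis (2 * \<alpha>)))\<^sup>2 = 1 - 2 * r\<^sup>2 * cos (2 * \<alpha>) + r ^ 4"
    unfolding root_eq_cmod[symmetric]
  proof (rule real_sqrt_pow2)
    have "0 \<le> (1 - r\<^sup>2)\<^sup>2 + (2 * r * sin \<alpha>)\<^sup>2"
      by simp
    then show "0 \<le> 1 - 2 * r\<^sup>2 * cos (2 * \<alpha>) + r ^ 4"
      unfolding cos_double_sin by (simp add: power2_eq_square power4_eq_xxxx algebra_simps)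
  qed
  then show ?thesis
    unfolding cos_double_sin by (simp add: power2_eq_square power4_eq_xxxx algebra_simps)
qed

lemma radius_over_cmod_centre:
  assumes "0 \<le> r" "r < 1" "0 \<le> sin \<alpha>"
  shows "0 \<le> 2 * r * sin \<alpha> / cmod (1 - of_real (r\<^sup>2) * cis (2 * \<alpha>))"
    and "2 * r * sin \<alpha> / cmod (1 - of_real (r\<^sup>2) * cis (2 * \<alpha>)) < 1"
    and "0 < cmod (1 - of_real (r\<^sup>2) * cis (2 * \<alpha>))"
proof -
  have r2: "r\<^sup>2 < 1"
    using assms by (simp add: power_less_one_iff)
  have "(2 * r * sin \<alpha>)\<^sup>2 < (cmod (1 - of_real (r\<^sup>2) * cis (2 * \<alpha>)))\<^sup>2"
    unfolding cmod_centre_sq using r2 by simp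
  then have lt: "2 * r * sin \<alpha> < cmod (1 - of_real (r\<^sup>2) * cis (2 * \<alpha>))"
    by (rule power2_less_imp_less) simp
  have nn: "0 \<le> 2 * r * sin \<alpha>"
    using assms by simp
  show pos: "0 < cmod (1 - of_real (r\<^sup>2) * cis (2 * \<alpha>))"
    using lt nn by linarith
  show "0 \<le> 2 * r * sin \<alpha> / cmod (1 - of_real (r\<^sup>2) * cis (2 * \<alpha>))"
    using nn pos by simp
  show "2 * r * sin \<alpha> / cmod (1 - of_real (r\<^sup>2) * cis (2 * \<alpha>)) < 1"
    using lt pos by simp
qed

lemma Re_centre_pos:
  assumes "\<bar>r\<bar> < 1"
  shows "0 < Re (1 - of_real (r\<^sup>2) * cis (2 * \<alpha>))"
proof -
  have r2: "r\<^sup>2 < 1"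
    using assms by (simp add: abs_square_less_1)
  have "r\<^sup>2 * cos (2 * \<alpha>) \<le> r\<^sup>2"
    by (simp add: mult_left_le)
  then show ?thesis
    using r2 by simp
qed

lemma M1_eq_Arg:
  assumes "\<bar>r\<bar> < 1"
  shows "M1 r \<alpha> = Arg (1 - of_real (r\<^sup>2) * cis (2 * \<alpha>))"
proof -
  let ?D = "1 - of_real (r\<^sup>2) * cis (2 * \<alpha>)"
  have re: "0 < Re ?D"
    by (rule Re_centre_pos[OF assms])
  then have nz: "?D \<noteq> 0"
    by (metis less_irrefl zero_complex.simps(1))
  have "\<bar>Arg ?D\<bar> < pi / 2"
    unfolding Arg_eq_Im_Ln[OF nz] using re Re_Ln_pos_lt[OF nz] by blast
  then have "arcsin (sin (Arg ?D)) = Arg ?D"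
    by (intro arcsin_sin) auto
  moreover have "sin (Arg ?D) = Im ?D / cmod ?D"
    by (rule sin_Arg[OF nz])
  ultimately show ?thesis
    unfolding M1_def root_eq_cmod by simp
qed

text \<open>The disc of centre \<open>1\<close> and radius \<open>\<rho>\<close> subtends the half-angle \<open>arcsin \<rho>\<close> at the origin.\<close>

lemma abs_Im_Ln_le_arcsin:
  assumes "cmod (v - 1) \<le> \<rho>" "\<rho> < 1"
  shows "\<bar>Im (Ln v)\<bar> \<le> arcsin \<rho>"
proof -
  have nz: "v \<noteq> 0"
    using assms by auto
  have "Re (1 - v) \<le> cmod (v - 1)"
    by (metis complex_Re_le_cmod norm_minus_commute)
  then have "0 < Re v"
    using assms by simp
  then have half: "\<bar>Im (Ln v)\<bar> < pi / 2"
    using Re_Ln_pos_lt[OF nz] by blast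
  let ?t = "Im (Ln v)"
  have "v = of_real (cmod v) * cis ?t"
    using nz by (metis Arg_eq_Im_Ln rcis_cmod_Arg rcis_def)
  then have "cis (- ?t) * v = of_real (cmod v) * (cis ?t * cis (- ?t))"
    by (metis mult.commute mult.left_commute)
  then have real: "cis (- ?t) * v = of_real (cmod v)"
    by (simp add: cis_mult)
  \<comment> \<open>\<open>\<bar>sin ?t\<bar>\<close> is the distance from \<open>1\<close> to the line through \<open>0\<close> and \<open>v\<close>, hence at most the distance
    from \<open>1\<close> to \<open>v\<close>; rotating by \<open>- ?t\<close> moves that line onto the real axis.\<close>
  have "\<bar>sin ?t\<bar> = \<bar>Im (cis (- ?t) * (v - 1))\<bar>"
    unfolding right_diff_distrib real by simp
  also have "\<dots> \<le> cmod (cis (- ?t) * (v - 1))"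
    by (rule abs_Im_le_cmod)
  also have "\<dots> \<le> \<rho>"
    using assms by (simp add: norm_mult)
  finally have sin_le: "\<bar>sin ?t\<bar> \<le> \<rho>" .
  have "sin \<bar>?t\<bar> \<le> \<rho>"
    using sin_le by (auto simp: abs_if split: if_splits)
  then have "arcsin (sin \<bar>?t\<bar>) \<le> arcsin \<rho>"
    using assms by (intro arcsin_le_arcsin) auto
  then show ?thesis
    using half by (simp add: arcsin_sin)
qed

text \<open>The same bound for a disc with arbitrary centre \<open>C\<close>, after division by \<open>C\<close>. It speaks of a
  logarithm \<open>T\<close> that need not be the principal one; the range hypothesis excludes a shift by
  \<open>2 * pi\<close>.\<close>

lemma abs_Im_diff_Arg_le_arcsin:
  assumes disc: "cmod (exp T - C) \<le> \<rho> * cmod C" and "\<rho> < 1" and "C \<noteq> 0"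
    and range: "\<bar>Im T - Arg C\<bar> < pi"
  shows "\<bar>Im T - Arg C\<bar> \<le> arcsin \<rho>"
proof -
  have quot: "exp (T - Ln C) = exp T / C"
    using assms by (simp add: exp_diff)
  have "cmod (exp T / C - 1) = cmod (exp T - C) / cmod C"
    using assms by (simp add: divide_simps flip: norm_divide)
  also have "\<dots> \<le> \<rho>"
    using assms by (simp add: divide_simps)
  finally have "\<bar>Im (Ln (exp (T - Ln C)))\<bar> \<le> arcsin \<rho>"
    unfolding quot using \<open>\<rho> < 1\<close> by (rule abs_Im_Ln_le_arcsin)
  moreover have "Ln (exp (T - Ln C)) = T - Ln C"
    using range assms by (intro Ln_exp) (auto simp: Arg_eq_Im_Ln)
  ultimately show ?thesis
    using assms by (simp add: Arg_eq_Im_Ln)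
qed

text \<open>The image of the disc of radius \<open>r\<close> under \<open>\<zeta> \<mapsto> (1 + \<zeta> * a) / (1 + \<zeta> * cnj a)\<close>. Subtracting the
  centre leaves \<open>(a - cnj a) / (1 - r\<^sup>2)\<close> times \<open>(\<zeta> + r\<^sup>2 * a) / (1 + \<zeta> * cnj a)\<close>. With
  \<open>\<zeta> = r * u\<close> the second factor is \<open>r * ((u + r * a) / (1 + u * cnj (r * a)))\<close>, that is, \<open>r\<close> times
  the value of a disc automorphism at \<open>u\<close>, so its modulus is at most \<open>r\<close>.\<close>

lemma moebius_in_disc:
  fixes a \<zeta> :: complex
  assumes a: "cmod a = 1" and zeta: "cmod \<zeta> \<le> r" and r: "r < 1"
  shows "cmod ((1 + \<zeta> * a) / (1 + \<zeta> * cnj a) - (1 - of_real (r\<^sup>2) * a\<^sup>2) / of_real (1 - r\<^sup>2))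
         \<le> 2 * r * \<bar>Im a\<bar> / (1 - r\<^sup>2)"
proof -
  have r0: "0 \<le> r"
    using zeta norm_ge_zero order_trans by blast
  then have r2: "0 < 1 - r\<^sup>2"
    using r by (simp add: power_less_one_iff)
  have unit: "a * cnj a = 1"
    using a by (simp flip: complex_norm_square)
  define d where "d = 1 + \<zeta> * cnj a"
  have dz: "d \<noteq> 0"
  proof
    assume "d = 0"
    then have "cmod (\<zeta> * cnj a) = 1"
      unfolding d_def by (metis add_eq_0_iff norm_minus_cancel norm_one)
    then show False
      using zeta r a by (simp add: norm_mult)
  qed
  have R: "of_real (1 - r\<^sup>2) \<noteq> (0 :: complex)"
    using r2 by (metis less_irrefl of_real_eq_0_iff)
  have "(1 + \<zeta> * a) * of_real (1 - r\<^sup>2) - (1 - of_real (r\<^sup>2) * a\<^sup>2) * d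
      = (a - cnj a) * (\<zeta> + of_real (r\<^sup>2) * a)"
    unfolding d_def of_real_diff of_real_1 using unit by algebra
  then have diff: "(1 + \<zeta> * a) / d - (1 - of_real (r\<^sup>2) * a\<^sup>2) / of_real (1 - r\<^sup>2)
      = (a - cnj a) * (\<zeta> + of_real (r\<^sup>2) * a) / (d * of_real (1 - r\<^sup>2))"
    using dz R by (simp add: diff_frac_eq)
  have sq: "(cmod (\<zeta> + of_real (r\<^sup>2) * a))\<^sup>2 \<le> (r * cmod d)\<^sup>2"
  proof -
    have a2: "(Re a)\<^sup>2 + (Im a)\<^sup>2 = 1"
      using a by (metis cmod_power2 one_power2)
    have "(r * cmod d)\<^sup>2 - (cmod (\<zeta> + of_real (r\<^sup>2) * a))\<^sup>2
        = (1 - r\<^sup>2) * (r\<^sup>2 - (cmod \<zeta>)\<^sup>2)"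
      unfolding power_mult_distrib cmod_power2 d_def
      using a2 by simp algebra
    moreover have "(cmod \<zeta>)\<^sup>2 \<le> r\<^sup>2"
      using zeta by (simp add: power_mono)
    then have "0 \<le> (1 - r\<^sup>2) * (r\<^sup>2 - (cmod \<zeta>)\<^sup>2)"
      using r2 by simp
    ultimately show ?thesis
      by linarith
  qed
  then have le: "cmod (\<zeta> + of_real (r\<^sup>2) * a) \<le> r * cmod d"
    by (rule power2_le_imp_le) (simp add: r0)
  have "a - cnj a = of_real (2 * Im a) * \<i>"
    by (simp add: complex_eq_iff)
  then have chord: "cmod (a - cnj a) = 2 * \<bar>Im a\<bar>"
    by (simp only: norm_mult norm_of_real norm_ii)
  have "cmod ((1 + \<zeta> * a) / d - (1 - of_real (r\<^sup>2) * a\<^sup>2) / of_real (1 - r\<^sup>2))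
      = 2 * \<bar>Im a\<bar> * cmod (\<zeta> + of_real (r\<^sup>2) * a) / (cmod d * (1 - r\<^sup>2))"
    unfolding diff norm_divide norm_mult chord norm_of_real using r2 by simp
  also have "\<dots> \<le> 2 * \<bar>Im a\<bar> * (r * cmod d) / (cmod d * (1 - r\<^sup>2))"
    using le r2 dz by (intro divide_right_mono mult_left_mono) auto
  also have "\<dots> = 2 * r * \<bar>Im a\<bar> / (1 - r\<^sup>2)"
    using dz by (simp add: divide_simps)
  finally show ?thesis
    unfolding d_def .
qed

lemma N_alt: "N r \<alpha> = (cmod (1 - of_real (r\<^sup>2) * cis (2 * \<alpha>)) + 2 * r * sin \<alpha>) / (1 - r\<^sup>2)"
  by (simp only: N_def root_eq_cmod)

text \<open>A point of the disc has modulus between \<open>cmod C - R\<close> and \<open>cmod C + R\<close>, and these two numbers are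
  reciprocal because their product is \<open>(cmod C)\<^sup>2 - R\<^sup>2 = 1\<close>.\<close>

lemma abs_ln_cmod_le_ln_N:
  assumes r: "0 \<le> r" "r < 1" and s: "0 \<le> sin \<alpha>"
    and disc: "cmod (w - (1 - of_real (r\<^sup>2) * cis (2 * \<alpha>)) / of_real (1 - r\<^sup>2))
      \<le> 2 * r * sin \<alpha> / (1 - r\<^sup>2)"
  shows "\<bar>ln (cmod w)\<bar> \<le> ln (N r \<alpha>)"
proof -
  define C where "C = (1 - of_real (r\<^sup>2) * cis (2 * \<alpha>)) / of_real (1 - r\<^sup>2)"
  define R where "R = 2 * r * sin \<alpha> / (1 - r\<^sup>2)"
  have r2: "0 < 1 - r\<^sup>2"
    using r by (simp add: power_less_one_iff)
  have C: "cmod C = cmod (1 - of_real (r\<^sup>2) * cis (2 * \<alpha>)) / (1 - r\<^sup>2)"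
    unfolding C_def norm_divide norm_of_real using r2 by simp
  have N: "N r \<alpha> = cmod C + R"
    unfolding N_alt C R_def by (simp add: add_divide_distrib)
  have "(cmod C + R) * (cmod C - R) = (cmod C)\<^sup>2 - R\<^sup>2"
    by (simp add: power2_eq_square algebra_simps)
  also have "\<dots> = 1"
    unfolding C R_def power_divide cmod_centre_sq using r2 by (simp flip: diff_divide_distrib)
  finally have inverse: "N r \<alpha> * (cmod C - R) = 1"
    unfolding N .
  have "0 \<le> R"
    unfolding R_def using r s r2 by simp
  then have Nnn: "0 \<le> N r \<alpha>"
    unfolding N by simp
  then have Npos: "0 < N r \<alpha>"
    using inverse by (cases "N r \<alpha> = 0") auto
  have lower: "1 / N r \<alpha> = cmod C - R"
    using inverse Npos by (simp add: field_simps)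
  have dist: "cmod (w - C) \<le> R"
    using disc unfolding C_def R_def .
  have upper: "cmod w \<le> N r \<alpha>"
    using dist norm_triangle_ineq2[of w C] unfolding N by linarith
  have below: "1 / N r \<alpha> \<le> cmod w"
    using dist norm_triangle_ineq2[of C w] unfolding lower by (simp add: norm_minus_commute)
  then have wpos: "0 < cmod w"
    using Npos by (meson less_le_trans zero_less_divide_1_iff)
  have "ln (1 / N r \<alpha>) \<le> ln (cmod w)"
    using below Npos wpos by (subst ln_le_cancel_iff) auto
  moreover have "ln (cmod w) \<le> ln (N r \<alpha>)"
    by (rule iffD2[OF ln_le_cancel_iff[OF wpos Npos] upper])
  ultimately show ?thesis
    using Npos by (simp add: ln_div)
qed

text \<open>The lower bound for the argument on the disc. The strip gives \<open>Im T\<close> only in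
  \<open>(\<alpha> - pi, \<alpha>)\<close>; the condition \<open>pi / 2 \<le> \<alpha>\<close> puts the argument of the centre into \<open>[0, pi / 2)\<close>,
  and then \<open>Im T\<close> is within \<open>pi\<close> of it, which identifies the branch of the logarithm.\<close>

lemma Im_log_ge_M1_M2:
  assumes r: "0 \<le> r" "r < 1" and \<alpha>: "pi / 2 \<le> \<alpha>" "\<alpha> < pi"
    and range: "\<alpha> - pi < Im T" "Im T < \<alpha>"
    and disc: "cmod (exp T - (1 - of_real (r\<^sup>2) * cis (2 * \<alpha>)) / of_real (1 - r\<^sup>2))
      \<le> 2 * r * sin \<alpha> / (1 - r\<^sup>2)"
  shows "M1 r \<alpha> - M2 r \<alpha> \<le> Im T"
proof -
  define D where "D = 1 - of_real (r\<^sup>2) * cis (2 * \<alpha>)"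
  define C where "C = D / of_real (1 - r\<^sup>2)"
  define \<rho> where "\<rho> = 2 * r * sin \<alpha> / cmod D"
  have s: "0 < sin \<alpha>"
    using \<alpha> pi_gt_zero by (simp add: sin_gt_zero)
  have r2: "0 < 1 - r\<^sup>2"
    using r by (simp add: power_less_one_iff)
  note bounds = radius_over_cmod_centre[OF r less_imp_le[OF s]]
  have rho: "\<rho> < 1"
    unfolding \<rho>_def D_def by (rule bounds(2))
  have Dpos: "0 < cmod D"
    unfolding D_def by (rule bounds(3))
  have Cz: "C \<noteq> 0"
    unfolding C_def using Dpos r2 by (metis divide_eq_0_iff less_irrefl norm_zero of_real_eq_0_iff)
  have "C = D * of_real (1 / (1 - r\<^sup>2))"
    unfolding C_def by simp
  then have ArgC: "Arg C = M1 r \<alpha>"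
    using r2 r by (simp add: M1_eq_Arg D_def Arg_times_of_real del: of_real_divide)
  have "\<rho> * cmod C = 2 * r * sin \<alpha> / (1 - r\<^sup>2)"
    unfolding \<rho>_def C_def norm_divide norm_of_real using Dpos r2 by simp
  then have dist: "cmod (exp T - C) \<le> \<rho> * cmod C"
    using disc unfolding C_def D_def by simp
  have "0 \<le> Arg C \<and> Arg C < pi / 2"
  proof -
    have "0 < Re D"
      unfolding D_def using r by (intro Re_centre_pos) simp
    then have half: "\<bar>Arg D\<bar> < pi / 2"
      using Dpos Re_Ln_pos_lt[of D] by (simp add: Arg_eq_Im_Ln)
    have "sin (2 * \<alpha>) \<le> 0"
      using \<alpha> s cos_monotone_0_pi_le[of "pi / 2" \<alpha>] unfolding sin_double
      by (simp add: mult_nonneg_nonpos)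
    then have "0 \<le> Im D"
      unfolding D_def by (simp add: mult_nonneg_nonpos)
    then have "0 \<le> Arg D"
      by (simp add: Arg_less_0)
    then show ?thesis
      using half ArgC r by (simp add: M1_eq_Arg D_def)
  qed
  then have "\<bar>Im T - Arg C\<bar> < pi"
    using range \<alpha> by linarith
  then have "\<bar>Im T - Arg C\<bar> \<le> arcsin \<rho>"
    by (rule abs_Im_diff_Arg_le_arcsin[OF dist rho Cz])
  moreover have "arcsin \<rho> = M2 r \<alpha>"
    unfolding M2_def root_eq_cmod \<rho>_def D_def ..
  ultimately show ?thesis
    unfolding ArgC by linarith
qed

section \<open>Subordination of functions with values in a strip\<close>

text \<open>At \<open>0\<close> the quotient is \<open>f'\<close> divided by the holomorphic extension of \<open>f(z) / z\<close>; both take the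
  value \<open>f'(0)\<close> there, which is nonzero by injectivity.\<close>

lemma star_quot_holomorphic:
  assumes holf: "f holomorphic_on unit_disc" and inj: "inj_on f unit_disc" and f0: "f 0 = 0"
  shows "star_quot f holomorphic_on unit_disc"
proof -
  define g where "g = (\<lambda>z. if z = 0 then deriv f 0 else (f z - f 0) / (z - 0))"
  have holg: "g holomorphic_on unit_disc"
    unfolding g_def by (rule pole_lemma[OF holf]) simp
  have d0: "deriv f 0 \<noteq> 0"
    by (rule holomorphic_injective_imp_regular[OF holf _ inj]) auto
  have fz: "f z \<noteq> 0" if "z \<in> unit_disc" "z \<noteq> 0" for z
    using inj_onD[OF inj, of z 0] that f0 by auto
  have "(\<lambda>z. deriv f z / g z) holomorphic_on unit_disc"
    using holf holg d0 fz f0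
    by (intro holomorphic_on_divide holomorphic_deriv) (auto simp: g_def)
  moreover have "deriv f z / g z = star_quot f z" for z
    using d0 f0 by (simp add: g_def star_quot_def)
  ultimately show ?thesis
    by simp
qed

text \<open>Solving \<open>exp p = (1 + W * a) / (1 + W * cnj a)\<close> for \<open>W\<close> with \<open>a = cis \<alpha>\<close> gives
  \<open>W = (exp p - 1) / (a - exp p * cnj a)\<close>. On the strip \<open>exp p\<close> lies on that side of the line
  through \<open>0\<close> and \<open>a\<close> that contains \<open>1\<close>. This line is the perpendicular bisector of \<open>1\<close> and
  \<open>a\<^sup>2\<close>, so \<open>exp p\<close> is closer to \<open>1\<close> than to \<open>a\<^sup>2\<close>, that is, \<open>cmod W < 1\<close>. The Schwarz lemma then
  applies to \<open>W\<close>.\<close>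

lemma strip_subordination:
  assumes hol: "p holomorphic_on unit_disc" and p0: "p 0 = 0" and \<alpha>: "0 < \<alpha>" "\<alpha> < pi"
    and strip: "\<And>z. z \<in> unit_disc \<Longrightarrow> \<alpha> - pi < Im (p z) \<and> Im (p z) < \<alpha>"
    and z: "z \<in> unit_disc"
  obtains \<zeta> where "cmod \<zeta> \<le> cmod z"
    and "exp (p z) = (1 + \<zeta> * cis \<alpha>) / (1 + \<zeta> * cnj (cis \<alpha>))"
proof -
  define a where "a = cis \<alpha>"
  have unit: "a * cnj a = 1"
    by (simp add: a_def cis_cnj cis_mult)
  have s: "0 < sin \<alpha>"
    using \<alpha> by (rule sin_gt_zero)
  define W where "W = (\<lambda>z. (exp (p z) - 1) / (a - exp (p z) * cnj a))"
  have closer: "cmod (exp (p z) - 1) < cmod (a - exp (p z) * cnj a)" if "z \<in> unit_disc" for z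
  proof -
    have neg: "sin (Im (p z) - \<alpha>) < 0"
      using strip[OF that] sin_gt_zero[of "\<alpha> - Im (p z)"] sin_minus[of "\<alpha> - Im (p z)"]
      by simp
    have "(cmod (a - exp (p z) * cnj a))\<^sup>2 - (cmod (exp (p z) - 1))\<^sup>2
        = - (4 * sin \<alpha> * (exp (Re (p z)) * sin (Im (p z) - \<alpha>)))"
      unfolding cmod_power2 sin_diff a_def
      apply (simp add: Re_exp Im_exp)
      using sin_cos_squared_add[of \<alpha>] sin_cos_squared_add[of "Im (p z)"]
      by algebra
    also have "\<dots> > 0"
      using s neg by (simp add: mult_pos_neg)
    finally have "(cmod (exp (p z) - 1))\<^sup>2 < (cmod (a - exp (p z) * cnj a))\<^sup>2"
      by simp
    then show ?thesis
      by (rule power2_less_imp_less) simp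
  qed
  have den: "a - exp (p z) * cnj a \<noteq> 0" if "z \<in> unit_disc" for z
    using closer[OF that] by auto
  have holW: "W holomorphic_on unit_disc"
    unfolding W_def using den hol by (auto intro!: holomorphic_intros)
  have W1: "cmod (W z) < 1" if "cmod z < 1" for z
    using closer[of z] den[of z] that by (simp add: W_def norm_divide)
  have "cmod (W z) \<le> cmod z"
    using Schwarz_Lemma(1)[OF holW _ W1] z by (simp add: W_def p0)
  moreover have "exp (p z) = (1 + W z * a) / (1 + W z * cnj a)"
  proof -
    let ?e = "exp (p z)"
    have "a - cnj a = of_real (2 * sin \<alpha>) * \<i>"
      by (simp add: a_def complex_eq_iff)
    then have nz: "a - cnj a \<noteq> 0"
      using s by simp
    have "1 + W z * a = ?e * (a - cnj a) / (a - ?e * cnj a)"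
      "1 + W z * cnj a = (a - cnj a) / (a - ?e * cnj a)"
      unfolding W_def using den[OF z] unit by (simp_all add: field_simps)
    then show ?thesis
      using den[OF z] nz by simp
  qed
  ultimately show ?thesis
    using that unfolding a_def by blast
qed

section \<open>The least root of the radius equation\<close>

definition radius_lhs :: "real \<Rightarrow> real \<Rightarrow> real" where
  "radius_lhs \<alpha> r = 1 / (4 * (sin \<alpha>)\<^sup>2) * (ln (N r \<alpha>))\<^sup>2 - 1 / sin \<alpha> * (M1 r \<alpha> - M2 r \<alpha>) - 1"

lemma radius_lhs_continuous:
  assumes s: "0 < sin \<alpha>" and b: "b < 1"
  shows "continuous_on {0..b} (radius_lhs \<alpha>)"
proof -
  have r2: "1 - r\<^sup>2 \<noteq> 0" if "r \<in> {0..b}" for r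
    using that b power_less_one_iff[of r 2] by auto
  note bounds = radius_over_cmod_centre[OF _ _ less_imp_le[OF s]]
  have M1r: "-1 \<le> - (r\<^sup>2 * sin (2 * \<alpha>)) / cmod (1 - of_real (r\<^sup>2) * cis (2 * \<alpha>)) \<and>
      - (r\<^sup>2 * sin (2 * \<alpha>)) / cmod (1 - of_real (r\<^sup>2) * cis (2 * \<alpha>)) \<le> 1"
    if "r \<in> {0..b}" for r
    using abs_Im_le_cmod[of "1 - of_real (r\<^sup>2) * cis (2 * \<alpha>)"] bounds(3)[of r] that b
    by (simp add: field_simps abs_le_iff)
  have M2r: "-1 \<le> 2 * r * sin \<alpha> / cmod (1 - of_real (r\<^sup>2) * cis (2 * \<alpha>)) \<and>
      2 * r * sin \<alpha> / cmod (1 - of_real (r\<^sup>2) * cis (2 * \<alpha>)) \<le> 1" if "r \<in> {0..b}" for r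
  proof -
    from that b have "0 \<le> r" "r < 1"
      by simp_all
    from bounds(1)[OF this] bounds(2)[OF this] show ?thesis
      by linarith
  qed
  have Npos: "N r \<alpha> \<noteq> 0" if "r \<in> {0..b}" for r
  proof -
    have "0 < cmod (1 - of_real (r\<^sup>2) * cis (2 * \<alpha>)) + 2 * r * sin \<alpha>"
      using bounds(3)[of r] that b s by (intro add_pos_nonneg) auto
    then show ?thesis
      unfolding N_alt using r2[OF that] by simp
  qed
  have D: "cmod (1 - of_real (r\<^sup>2) * cis (2 * \<alpha>)) \<noteq> 0" if "r \<in> {0..b}" for r
    using bounds(3)[of r] that b by auto
  have cN: "continuous_on {0..b} (\<lambda>r. N r \<alpha>)"
    unfolding N_alt using r2 by (intro continuous_intros) auto
  have c1: "continuous_on {0..b} (\<lambda>r. M1 r \<alpha>)"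
    unfolding M1_def root_eq_cmod using M1r D by (intro continuous_intros) blast+
  have c2: "continuous_on {0..b} (\<lambda>r. M2 r \<alpha>)"
    unfolding M2_def root_eq_cmod using M2r D by (intro continuous_intros) blast+
  show ?thesis
    unfolding radius_lhs_def using cN c1 c2 Npos by (intro continuous_intros) blast+
qed

lemma radius_lhs_0: "radius_lhs \<alpha> 0 = -1"
  by (simp add: radius_lhs_def N_def M1_def M2_def)

text \<open>\<open>M1 - M2\<close> is bounded by \<open>pi\<close>, while \<open>N\<close> tends to infinity as \<open>r\<close> tends to \<open>1\<close>. An explicit
  witness \<open>b\<close> is enough here.\<close>

lemma radius_lhs_pos_near_1:
  assumes s: "0 < sin \<alpha>"
  obtains b where "0 < b" "b < 1" "0 < radius_lhs \<alpha> b"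
proof -
  \<comment> \<open>\<open>K\<close> makes \<open>ln K / (2 * sin \<alpha>) = t\<close> with \<open>t = pi / sin \<alpha> + 2\<close>, so that \<open>t\<^sup>2 \<ge> t\<close> exceeds
    \<open>pi / sin \<alpha> + 1\<close>; \<open>b\<close> is chosen so that \<open>sin \<alpha> / (1 - b\<^sup>2) = 2 * K\<close>.\<close>
  define K where "K = exp (2 * pi + 4 * sin \<alpha>)"
  define b where "b = sqrt (1 - sin \<alpha> / (2 * K))"
  have K1: "1 \<le> K"
    unfolding K_def using s pi_gt_zero by (simp add: add_nonneg_nonneg)
  have small: "0 < sin \<alpha> / (2 * K)" "sin \<alpha> / (2 * K) \<le> 1 / 2"
    using s K1 order_trans[OF sin_le_one K1, of \<alpha>] by (auto simp: field_simps)
  have b2: "b\<^sup>2 = 1 - sin \<alpha> / (2 * K)"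
    unfolding b_def using small by simp
  have b0: "0 < b" and b1: "b < 1"
    unfolding b_def using small by auto
  have "b\<^sup>2 \<le> b"
    using b0 b1 by (simp add: power2_eq_square mult_left_le)
  then have half: "1 \<le> 2 * b"
    using b2 small by linarith
  have "sin \<alpha> \<le> cmod (1 - of_real (b\<^sup>2) * cis (2 * \<alpha>)) + 2 * b * sin \<alpha>"
    using half s mult_right_mono[of 1 "2 * b" "sin \<alpha>"]
      norm_ge_zero[of "1 - of_real (b\<^sup>2) * cis (2 * \<alpha>)"] by linarith
  then have "sin \<alpha> / (1 - b\<^sup>2) \<le> N b \<alpha>"
    unfolding N_alt using b2 small by (intro divide_right_mono) auto
  moreover have "sin \<alpha> / (1 - b\<^sup>2) = 2 * K"
    unfolding b2 using s K1 by simp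
  ultimately have "K \<le> N b \<alpha>"
    using K1 by linarith
  then have "ln K \<le> ln (N b \<alpha>)"
    using K1 by (subst ln_le_cancel_iff) auto
  then have lnN: "2 * sin \<alpha> * (pi / sin \<alpha> + 2) \<le> ln (N b \<alpha>)"
    unfolding K_def using s by (simp add: algebra_simps)
  define t where "t = pi / sin \<alpha> + 2"
  have t2: "2 \<le> t"
    unfolding t_def using s by simp
  have "(2 * sin \<alpha> * t)\<^sup>2 \<le> (ln (N b \<alpha>))\<^sup>2"
    using lnN s t2 unfolding t_def[symmetric] by (intro power_mono) auto
  then have "t\<^sup>2 \<le> 1 / (4 * (sin \<alpha>)\<^sup>2) * (ln (N b \<alpha>))\<^sup>2"
    using s by (simp add: power_mult_distrib field_simps)
  moreover have "t \<le> t\<^sup>2"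
    using t2 by (simp add: power2_eq_square)
  moreover have "M1 b \<alpha> - M2 b \<alpha> \<le> pi"
  proof -
    note bounds = radius_over_cmod_centre[OF less_imp_le[OF b0] b1 less_imp_le[OF s]]
    have "M1 b \<alpha> \<le> pi / 2"
      using b0 b1 Re_centre_pos[of b \<alpha>] Re_Ln_pos_lt[of "1 - of_real (b\<^sup>2) * cis (2 * \<alpha>)"]
        bounds(3)
      by (simp add: M1_eq_Arg Arg_eq_Im_Ln)
    moreover have "0 \<le> M2 b \<alpha>"
      unfolding M2_def root_eq_cmod
      by (rule arcsin_nonneg) (simp only: atLeastAtMost_iff bounds(1) less_imp_le[OF bounds(2)])
    ultimately show ?thesis
      using pi_gt_zero by linarith
  qed
  then have "1 / sin \<alpha> * (M1 b \<alpha> - M2 b \<alpha>) \<le> pi / sin \<alpha>"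
    using s by (simp add: divide_right_mono)
  ultimately have "0 < radius_lhs \<alpha> b"
    unfolding radius_lhs_def t_def by linarith
  then show ?thesis
    using that b0 b1 by blast
qed

lemma least_zero:
  fixes g :: "real \<Rightarrow> real"
  assumes cont: "continuous_on {a..b} g" and "a < b" "g a < 0" "0 < g b"
  obtains c where "a < c" "c \<le> b" "g c = 0" "\<And>x. a < x \<Longrightarrow> x \<le> b \<Longrightarrow> g x = 0 \<Longrightarrow> c \<le> x"
proof -
  define Z where "Z = {x \<in> {a..b}. g x = 0}"
  have "closed Z"
    unfolding Z_def using cont by (intro continuous_closed_preimage_constant) auto
  then have "compact Z"
    unfolding compact_eq_bounded_closed Z_def
    by (auto intro: bounded_subset[OF bounded_closed_interval])
  moreover have "Z \<noteq> {}"
    using IVT'[of g a 0 b] assms by (auto simp: Z_def)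
  ultimately obtain c where c: "c \<in> Z" and least: "\<forall>x\<in>Z. c \<le> x"
    using compact_attains_inf[of Z] by blast
  have zero: "g c = 0" and cb: "c \<le> b" and ac: "a \<le> c"
    using c unfolding Z_def by auto
  have "c \<noteq> a"
    using zero \<open>g a < 0\<close> by auto
  moreover have "c \<le> x" if "a < x" "x \<le> b" "g x = 0" for x
    using least that unfolding Z_def by simp
  ultimately show ?thesis
    using that[of c] zero cb ac by simp
qed

section \<open>The parabolic condition\<close>

text \<open>The region is the closed interior of the parabola with focus \<open>1\<close> and the imaginary axis as
  directrix.\<close>

lemma parabolic_iff:
  fixes q :: complex
  shows "cmod (q - 1) \<le> Re q \<longleftrightarrow> (Im q)\<^sup>2 \<le> 2 * Re q - 1"
proof -
  have sq: "(cmod (q - 1))\<^sup>2 = (Re q)\<^sup>2 + ((Im q)\<^sup>2 - (2 * Re q - 1))"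
    unfolding cmod_power2 by (simp add: power2_eq_square algebra_simps)
  show ?thesis
  proof
    assume "cmod (q - 1) \<le> Re q"
    then have "(cmod (q - 1))\<^sup>2 \<le> (Re q)\<^sup>2"
      by (simp add: power_mono)
    then show "(Im q)\<^sup>2 \<le> 2 * Re q - 1"
      using sq by linarith
  next
    assume le: "(Im q)\<^sup>2 \<le> 2 * Re q - 1"
    then have "0 \<le> Re q"
      using zero_le_power2[of "Im q"] by linarith
    moreover have "(cmod (q - 1))\<^sup>2 \<le> (Re q)\<^sup>2"
      using sq le by linarith
    ultimately show "cmod (q - 1) \<le> Re q"
      by (rule power2_le_imp_le[rotated])
  qed
qed

text \<open>A single inequality at the radius \<open>r\<close> gives the parabolic condition on the
  whole closed disc, because the image disc for \<open>cmod \<zeta> \<le> r\<close> contains the values for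
  all smaller moduli as well.\<close>

lemma MS_parabolic_at:
  assumes \<alpha>: "pi / 2 \<le> \<alpha>" "\<alpha> < pi" and r: "0 \<le> r" "r < 1" and rad: "radius_lhs \<alpha> r \<le> 0"
    and f: "f \<in> MS \<alpha>" and z: "cmod z \<le> r"
  shows "parabolic_at f z"
proof -
  have s: "0 < sin \<alpha>"
    using \<alpha> pi_gt_zero by (intro sin_gt_zero) linarith+
  have zU: "z \<in> unit_disc"
    using z r by simp
  from f have holf: "f holomorphic_on unit_disc" and inj: "inj_on f unit_disc"
    and ser: "\<exists>a. \<forall>z\<in>unit_disc. (\<lambda>n. a (n + 2) * z ^ (n + 2)) sums (f z - z)"
    unfolding MS_def class_A_def by blast+
  have f0: "f 0 = 0"
  proof -
    \<comment> \<open>every term of the series for \<open>f z - z\<close> vanishes at \<open>z = 0\<close>\<close>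
    from ser obtain a where a: "\<forall>z\<in>unit_disc. (\<lambda>n. a (n + 2) * z ^ (n + 2)) sums (f z - z)"
      by blast
    have "(\<lambda>n. a (n + 2) * 0 ^ (n + 2)) sums (f 0 - 0)"
      using bspec[OF a, of 0] by simp
    then have "(\<lambda>n. 0) sums f 0"
      by simp
    then show ?thesis
      by (rule sums_unique2[OF _ sums_zero])
  qed
  define p where "p = (\<lambda>z. 2 * \<i> * of_real (sin \<alpha>) * (star_quot f z - 1))"
  have holp: "p holomorphic_on unit_disc"
    unfolding p_def by (intro holomorphic_intros star_quot_holomorphic[OF holf inj f0])
  have p0: "p 0 = 0"
    by (simp add: p_def star_quot_def)
  have Imp: "Im (p z) = 2 * sin \<alpha> * (Re (star_quot f z) - 1)"
    and Rep: "Re (p z) = - (2 * sin \<alpha> * Im (star_quot f z))" for z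
    by (simp_all add: p_def)
  have strip: "\<alpha> - pi < Im (p z) \<and> Im (p z) < \<alpha>" if "z \<in> unit_disc" for z
  proof -
    have "1 + (\<alpha> - pi) / (2 * sin \<alpha>) < Re (star_quot f z) \<and>
        Re (star_quot f z) < 1 + \<alpha> / (2 * sin \<alpha>)"
      using f that unfolding MS_def by blast
    then show ?thesis
      unfolding Imp using s by (simp add: field_simps)
  qed
  have \<alpha>0: "0 < \<alpha>"
    using \<alpha> pi_gt_zero by linarith
  obtain \<zeta> where zeta: "cmod \<zeta> \<le> cmod z"
    and w: "exp (p z) = (1 + \<zeta> * cis \<alpha>) / (1 + \<zeta> * cnj (cis \<alpha>))"
    using strip_subordination[OF holp p0 \<alpha>0 \<alpha>(2) strip zU] .
  have disc: "cmod (exp (p z) - (1 - of_real (r\<^sup>2) * cis (2 * \<alpha>)) / of_real (1 - r\<^sup>2))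
      \<le> 2 * r * sin \<alpha> / (1 - r\<^sup>2)"
    unfolding w using moebius_in_disc[of "cis \<alpha>" \<zeta> r] zeta z r s by (simp add: Complex.DeMoivre)
  have "\<bar>ln (cmod (exp (p z)))\<bar> \<le> ln (N r \<alpha>)"
    by (rule abs_ln_cmod_le_ln_N[OF r less_imp_le[OF s] disc])
  then have "\<bar>Re (p z)\<bar> \<le> ln (N r \<alpha>)"
    by simp
  then have "(Re (p z))\<^sup>2 \<le> (ln (N r \<alpha>))\<^sup>2"
    by (metis abs_ge_zero power2_abs power_mono)
  then have "1 / (4 * (sin \<alpha>)\<^sup>2) * (Re (p z))\<^sup>2 \<le> 1 / (4 * (sin \<alpha>)\<^sup>2) * (ln (N r \<alpha>))\<^sup>2"
    by (intro mult_left_mono) auto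
  also have "\<dots> \<le> 1 / sin \<alpha> * (M1 r \<alpha> - M2 r \<alpha>) + 1"
    using rad unfolding radius_lhs_def by linarith
  also have "\<dots> \<le> 1 / sin \<alpha> * Im (p z) + 1"
    using Im_log_ge_M1_M2[OF r \<alpha> _ _ disc] strip[OF zU] s
    by (intro add_right_mono mult_left_mono) auto
  finally have "(Im (star_quot f z))\<^sup>2 \<le> 2 * Re (star_quot f z) - 1"
    unfolding Rep Imp using s by (simp add: power_mult_distrib)
  then show ?thesis
    unfolding parabolic_at_def parabolic_iff .
qed

theorem theorem7:
  fixes \<alpha> :: real
  assumes "pi / 2 \<le> \<alpha>" and "\<alpha> < pi"
  shows "\<exists>r2. 0 < r2 \<and> r2 < 1 \<and> radius_eq \<alpha> r2 \<and>
      (\<forall>r. 0 < r \<and> r < 1 \<and> radius_eq \<alpha> r \<longrightarrow> r2 \<le> r) \<and>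
      (\<forall>f\<in>MS \<alpha>. \<forall>z. cmod z \<le> r2 \<longrightarrow> parabolic_at f z)"
proof -
  have eq: "radius_eq \<alpha> r \<longleftrightarrow> radius_lhs \<alpha> r = 0" for r
    by (simp add: radius_eq_def radius_lhs_def)
  have s: "0 < sin \<alpha>"
    using assms pi_gt_zero by (intro sin_gt_zero) linarith+
  obtain b where b: "0 < b" "b < 1" "0 < radius_lhs \<alpha> b"
    using radius_lhs_pos_near_1[OF s] .
  obtain c where c: "0 < c" "c \<le> b" "radius_lhs \<alpha> c = 0"
    and least: "\<And>x. 0 < x \<Longrightarrow> x \<le> b \<Longrightarrow> radius_lhs \<alpha> x = 0 \<Longrightarrow> c \<le> x"
    using least_zero[OF radius_lhs_continuous[OF s b(2)] b(1) _ b(3)] by (auto simp: radius_lhs_0)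
  have "\<forall>r. 0 < r \<and> r < 1 \<and> radius_eq \<alpha> r \<longrightarrow> c \<le> r"
    unfolding eq using least c(2) by (metis linear order_trans)
  moreover have "\<forall>f\<in>MS \<alpha>. \<forall>z. cmod z \<le> c \<longrightarrow> parabolic_at f z"
    using MS_parabolic_at[OF assms, of c] b c by auto
  ultimately show ?thesis
    using b c eq by (intro exI[of _ c]) auto
qed

end
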